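(* Let $n=k+m$ with integers $k\ge m\ge1$, and consider the two-block voting chain defined in the context, with $\alpha_A,\alpha_B\in(0,1]$. Let $r_A=\frac{1-\alpha_A}{\alpha_A}$. The condition $k-m\ge n\,r_A$ is equivalent to $$\alpha_A\ \ge\ \frac{n}{n+(k-m)},$$ and whenever it holds, no leakage pattern can overturn the majority: for all admissible $\lambda_A,\lambda_B\in[0,1]$ (with $\lambda_X=1$ if block $X$ is a singleton), the chain does not resolve to $p_B$, i.e. it is not the case that $M_B>M_A$.
   Context: Two-block voting chain. There are $n=k+m$ voters, split into a block $A$ of $k$ voters and a block $B$ of $m$ voters, with $k\ge m\ge1$, and two policies (answer letters) $p_A$ and $p_B$. All voters of block $A$ pick $p_A$, and all voters of block $B$ pick $p_B$. The voting matrix $V$ is the $(n+2)\times(n+2)$ column-stochastic matrix indexed by the voters and the two policies, where column $j$ is the outgoing distribution of state $j$ (so $V_{i,j}$ is the mass sent from $j$ to $i$). Each policy is absorbing: $V_{p,p}=1$. For $X\in\{A,B\}$, let $Y$ be the other block and $p_X$ the pick of block $X$. Every voter $j\in X$ has the column: - $V_{p_X,j}=\alpha_X$; - $V_{i,j}=(1-\alpha_X)\lambda_X/|Y|$ for every voter $i\in Y$; - $V_{i,j}=(1-\alpha_X)(1-\lambda_X)/(|X|-1)$ for every voter $i\in X$, $i\ne j$; - $V_{j,j}=0$, and $V_{p_Y,j}=0$. Here $\alpha_X\in(0,1]$ is the own-pick confidence of block $X$, and $\lambda_X\in[0,1]$ is its leakage (the fraction of the delegated mass that crosses to the other block). If $|X|=1$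 there are no same-block peers and $\lambda_X=1$ is required. Let $W^*=\lim_{x\to\infty}V^x$. The total mass absorbed at policy $p_X$ is $M_X=\sum_{j}W^*_{p_X,j}$, with the sum over the $n$ voters $j$. The chain (the Propagational Proxy Voting mechanism, PPV) selects the policy with the largest absorbed mass; it resolves to $p_B$ (overturns the majority) when $M_B>M_A$. *)

theory Defs
  imports Complex_Main "Jordan_Normal_Form.Matrix"
begin

datatype block = Block_A | Block_B

fun other :: "block \<Rightarrow> block" where
  "other Block_A = Block_B"
| "other Block_B = Block_A"

text \<open>
  The states are the numbers below \<open>k + m + 2\<close>: first the \<open>k\<close> voters of block A, then the \<open>m\<close>
  voters of block B, then the two policies. Confidence and leakage are functions of the block.
\<close>

fun voters :: "nat \<Rightarrow> nat \<Rightarrow> block \<Rightarrow> nat set" where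
  "voters k m Block_A = {0..<k}"
| "voters k m Block_B = {k..<k + m}"

fun policy :: "nat \<Rightarrow> nat \<Rightarrow> block \<Rightarrow> nat" where
  "policy k m Block_A = k + m"
| "policy k m Block_B = k + m + 1"

definition block_of :: "nat \<Rightarrow> nat \<Rightarrow> block" where
  "block_of k j = (if j < k then Block_A else Block_B)"

text \<open>
  The outgoing distribution of a voter \<open>j\<close> of block \<open>X\<close>, as a function of the target state \<open>i\<close>.
  For \<open>|X| = 1\<close> the same-block case, whose denominator would be \<open>0\<close>, is never reached.
\<close>

definition voter_column ::
    "nat \<Rightarrow> nat \<Rightarrow> (block \<Rightarrow> real) \<Rightarrow> (block \<Rightarrow> real) \<Rightarrow> block \<Rightarrow> nat \<Rightarrow> nat \<Rightarrow> real" where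
  "voter_column k m \<alpha> lam X j i =
     (if i = policy k m X then \<alpha> X
      else if i \<in> voters k m (other X)
        then (1 - \<alpha> X) * lam X / real (card (voters k m (other X)))
      else if i \<in> voters k m X \<and> i \<noteq> j
        then (1 - \<alpha> X) * (1 - lam X) / (real (card (voters k m X)) - 1)
      else 0)"

definition voting_matrix ::
    "nat \<Rightarrow> nat \<Rightarrow> (block \<Rightarrow> real) \<Rightarrow> (block \<Rightarrow> real) \<Rightarrow> real mat" where
  "voting_matrix k m \<alpha> lam = mat (k + m + 2) (k + m + 2) (\<lambda>(i, j).
     if j < k + m then voter_column k m \<alpha> lam (block_of k j) j i
     else if i = j then 1 else 0)"

definition admissible_leakage :: "nat \<Rightarrow> nat \<Rightarrow> (block \<Rightarrow> real) \<Rightarrow> bool" where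
  "admissible_leakage k m lam \<longleftrightarrow>
     (\<forall>X. 0 \<le> lam X \<and> lam X \<le> 1 \<and> (card (voters k m X) = 1 \<longrightarrow> lam X = 1))"

text \<open>The entrywise limit exists for all admissible parameters, see \<open>voting_matrix_convergent\<close> below.\<close>

definition limit_matrix ::
    "nat \<Rightarrow> nat \<Rightarrow> (block \<Rightarrow> real) \<Rightarrow> (block \<Rightarrow> real) \<Rightarrow> real mat" where
  "limit_matrix k m \<alpha> lam = mat (k + m + 2) (k + m + 2) (\<lambda>(i, j).
     lim (\<lambda>x. (voting_matrix k m \<alpha> lam ^\<^sub>m x) $$ (i, j)))"

definition absorbed_mass ::
    "nat \<Rightarrow> nat \<Rightarrow> (block \<Rightarrow> real) \<Rightarrow> (block \<Rightarrow> real) \<Rightarrow> block \<Rightarrow> real" where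
  "absorbed_mass k m \<alpha> lam X = (\<Sum>j<k + m. limit_matrix k m \<alpha> lam $$ (policy k m X, j))"

definition overturns_majority ::
    "nat \<Rightarrow> nat \<Rightarrow> (block \<Rightarrow> real) \<Rightarrow> (block \<Rightarrow> real) \<Rightarrow> bool" where
  "overturns_majority k m \<alpha> lam \<longleftrightarrow>
     absorbed_mass k m \<alpha> lam Block_B > absorbed_mass k m \<alpha> lam Block_A"

lemma sum_states:
  fixes f :: "nat \<Rightarrow> real"
  shows "(\<Sum>i<k + m + 2. f i) =
    sum f (voters k m Block_A) + sum f (voters k m Block_B) + f (k + m) + f (k + m + 1)"
proof -
  have "(\<Sum>i<k + m + 2. f i) = sum f {0..<k + m} + f (k + m) + f (k + m + 1)"
    by (simp add: numeral_2_eq_2 lessThan_atLeast0)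
  also have "sum f {0..<k + m} = sum f {0..<k} + sum f {k..<k + m}"
    by (simp add: sum.atLeastLessThan_concat)
  finally show ?thesis by simp
qed

lemma card_voters_pos:
  assumes "1 \<le> k" "1 \<le> m"
  shows "card (voters k m X) \<ge> 1"
  using assms by (cases X) auto

lemma voter_column_nonneg:
  assumes "1 \<le> k" "1 \<le> m" "\<forall>X. 0 < \<alpha> X \<and> \<alpha> X \<le> 1" "admissible_leakage k m lam"
  shows "0 \<le> voter_column k m \<alpha> lam X j i"
proof -
  have "0 \<le> \<alpha> X" "0 \<le> 1 - \<alpha> X" "0 \<le> lam X" "0 \<le> 1 - lam X"
    using spec[OF assms(3), of X] assms(4) by (auto simp: admissible_leakage_def)
  moreover have "0 \<le> real (card (voters k m X)) - 1"
    using card_voters_pos[OF assms(1,2), of X] by simp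
  ultimately show ?thesis unfolding voter_column_def by simp
qed

lemma voter_column_sum_voters:
  assumes "1 \<le> k" "1 \<le> m" "admissible_leakage k m lam" "j \<in> voters k m X"
  shows "sum (voter_column k m \<alpha> lam X j) (voters k m Block_A) +
         sum (voter_column k m \<alpha> lam X j) (voters k m Block_B) = 1 - \<alpha> X"
proof -
  let ?f = "voter_column k m \<alpha> lam X j"
  let ?c = "\<lambda>X. card (voters k m X)"
  have fin: "finite (voters k m X)" for X by (cases X) auto
  have np: "policy k m X \<notin> voters k m Z" for Z by (cases X; cases Z) auto
  have disj: "i \<in> voters k m X \<Longrightarrow> i \<notin> voters k m (other X)" for i by (cases X) auto
  have "sum ?f (voters k m (other X)) =
      (\<Sum>i\<in>voters k m (other X). (1 - \<alpha> X) * lam X / real (?c (other X)))"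
    using np by (intro sum.cong) (auto simp: voter_column_def)
  then have o: "sum ?f (voters k m (other X)) = (1 - \<alpha> X) * lam X"
    using card_voters_pos[OF assms(1,2), of "other X"] by simp
  have "sum ?f (voters k m X) = sum ?f (voters k m X - {j}) + ?f j"
    using sum.remove[OF fin assms(4), of ?f] by simp
  also have "?f j = 0" using np disj assms(4) by (auto simp: voter_column_def)
  also have "sum ?f (voters k m X - {j}) =
      (\<Sum>i\<in>voters k m X - {j}. (1 - \<alpha> X) * (1 - lam X) / (real (?c X) - 1))"
    using np disj by (intro sum.cong) (auto simp: voter_column_def)
  also have "\<dots> = (real (?c X) - 1) * ((1 - \<alpha> X) * (1 - lam X) / (real (?c X) - 1))"
    using card_voters_pos[OF assms(1,2), of X] assms(4) fin by (simp add: of_nat_diff)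
  also have "\<dots> = (1 - \<alpha> X) * (1 - lam X)"
    using assms(3) by (cases "?c X = 1") (auto simp: admissible_leakage_def)
  finally have "sum ?f (voters k m X) + sum ?f (voters k m (other X)) = 1 - \<alpha> X"
    using o by (simp add: algebra_simps)
  then show ?thesis by (cases X) auto
qed

lemma voting_matrix_nonneg:
  assumes "1 \<le> k" "1 \<le> m" "\<forall>X. 0 < \<alpha> X \<and> \<alpha> X \<le> 1" "admissible_leakage k m lam"
    and "i < k + m + 2" "j < k + m + 2"
  shows "0 \<le> voting_matrix k m \<alpha> lam $$ (i, j)"
  using voter_column_nonneg[OF assms(1-4)] assms(5,6) by (simp add: voting_matrix_def)

lemma voting_matrix_sum_voters:
  assumes "1 \<le> k" "1 \<le> m" "admissible_leakage k m lam" "j < k + m"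
  shows "(\<Sum>i<k + m. voting_matrix k m \<alpha> lam $$ (i, j)) = 1 - \<alpha> (block_of k j)"
proof -
  have "j \<in> voters k m (block_of k j)" using assms(4) by (auto simp: block_of_def)
  from voter_column_sum_voters[OF assms(1-3) this, of \<alpha>]
  have "sum (voter_column k m \<alpha> lam (block_of k j) j) {0..<k + m} = 1 - \<alpha> (block_of k j)"
    by (simp add: sum.atLeastLessThan_concat)
  then show ?thesis using assms(4) by (simp add: voting_matrix_def lessThan_atLeast0)
qed

lemma voting_matrix_column_stochastic:
  assumes "1 \<le> k" "1 \<le> m" "admissible_leakage k m lam" "j < k + m + 2"
  shows "(\<Sum>i<k + m + 2. voting_matrix k m \<alpha> lam $$ (i, j)) = 1"
proof (cases "j < k + m")
  case True
  have "(\<Sum>i<k + m + 2. voting_matrix k m \<alpha> lam $$ (i, j)) =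
      (\<Sum>i<k + m. voting_matrix k m \<alpha> lam $$ (i, j)) + \<alpha> (block_of k j)"
    using True by (cases "block_of k j") (auto simp: voting_matrix_def voter_column_def numeral_2_eq_2)
  then show ?thesis using voting_matrix_sum_voters[OF assms(1-3) True, of \<alpha>] by simp
next
  case False
  then show ?thesis using assms(4) by (simp add: voting_matrix_def)
qed

lemma times_mat_entry:
  fixes A B :: "real mat"
  assumes "A \<in> carrier_mat N N" "B \<in> carrier_mat N N" "i < N" "j < N"
  shows "(A * B) $$ (i, j) = (\<Sum>l<N. A $$ (i, l) * B $$ (l, j))"
  using assms by (auto simp: scalar_prod_def lessThan_atLeast0)

lemma voting_matrix_carrier: "voting_matrix k m \<alpha> lam \<in> carrier_mat (k + m + 2) (k + m + 2)"
  by (simp add: voting_matrix_def)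

lemma pow_mat_Suc_left:
  fixes A :: "real mat"
  assumes "A \<in> carrier_mat N N"
  shows "A ^\<^sub>m Suc x = A * A ^\<^sub>m x"
proof (induction x)
  case 0
  then show ?case using assms by auto
next
  case (Suc x)
  have "A ^\<^sub>m Suc (Suc x) = (A * A ^\<^sub>m x) * A" using Suc by simp
  also have "\<dots> = A * (A ^\<^sub>m x * A)"
    using assms by (intro assoc_mult_mat) (auto intro: pow_carrier_mat)
  finally show ?case by simp
qed

lemma voting_matrix_power:
  assumes "1 \<le> k" "1 \<le> m" "\<forall>X. 0 < \<alpha> X \<and> \<alpha> X \<le> 1" "admissible_leakage k m lam"
    and "j < k + m + 2"
  shows "(\<forall>i<k + m + 2. 0 \<le> (voting_matrix k m \<alpha> lam ^\<^sub>m x) $$ (i, j)) \<and>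
    (\<Sum>i<k + m + 2. (voting_matrix k m \<alpha> lam ^\<^sub>m x) $$ (i, j)) = 1"
proof (induction x)
  case 0
  then show ?case using assms(5) by (simp add: voting_matrix_def)
next
  case (Suc x)
  let ?V = "voting_matrix k m \<alpha> lam" and ?N = "k + m + 2"
  have e: "(?V ^\<^sub>m Suc x) $$ (i, j) = (\<Sum>l<?N. ?V $$ (i, l) * (?V ^\<^sub>m x) $$ (l, j))"
    if "i < ?N" for i
    using times_mat_entry[OF voting_matrix_carrier pow_carrier_mat[OF voting_matrix_carrier] that assms(5)]
    by (simp only: pow_mat_Suc_left[OF voting_matrix_carrier])
  have "(\<Sum>i<?N. (?V ^\<^sub>m Suc x) $$ (i, j)) =
      (\<Sum>i<?N. \<Sum>l<?N. ?V $$ (i, l) * (?V ^\<^sub>m x) $$ (l, j))"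
    by (intro sum.cong refl e) auto
  also have "\<dots> = (\<Sum>l<?N. \<Sum>i<?N. ?V $$ (i, l) * (?V ^\<^sub>m x) $$ (l, j))"
    by (rule sum.swap)
  also have "\<dots> = (\<Sum>l<?N. (\<Sum>i<?N. ?V $$ (i, l)) * (?V ^\<^sub>m x) $$ (l, j))"
    by (simp only: sum_distrib_right)
  also have "\<dots> = (\<Sum>l<?N. (?V ^\<^sub>m x) $$ (l, j))"
    using voting_matrix_column_stochastic[OF assms(1,2,4)] by (intro sum.cong refl) auto
  finally have s: "(\<Sum>i<?N. (?V ^\<^sub>m Suc x) $$ (i, j)) = 1" using Suc by simp
  have "0 \<le> (?V ^\<^sub>m Suc x) $$ (i, j)" if "i < ?N" for i
    unfolding e[OF that] using Suc voting_matrix_nonneg[OF assms(1-4) that]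
    by (intro sum_nonneg) auto
  with s show ?case by blast
qed

lemma voting_matrix_convergent:
  assumes "1 \<le> k" "1 \<le> m" "\<forall>X. 0 < \<alpha> X \<and> \<alpha> X \<le> 1" "admissible_leakage k m lam"
    and i: "i < k + m + 2" and j: "j < k + m + 2"
  shows "convergent (\<lambda>x. (voting_matrix k m \<alpha> lam ^\<^sub>m x) $$ (i, j))"
proof -
  let ?V = "voting_matrix k m \<alpha> lam" and ?N = "k + m + 2"
  let ?P = "\<lambda>x i. (?V ^\<^sub>m x) $$ (i, j)"
  note pw = voting_matrix_power[OF assms(1-4) j]
  have e: "?P (Suc x) i = (\<Sum>l<?N. ?V $$ (i, l) * ?P x l)" if "i < ?N" for i x
    using times_mat_entry[OF voting_matrix_carrier pow_carrier_mat[OF voting_matrix_carrier] that j]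
    by (simp only: pow_mat_Suc_left[OF voting_matrix_carrier])
  have le1: "?P x i \<le> 1" if "i < ?N" for x i
    using member_le_sum[of i "{..<?N}" "?P x"] that pw by auto
  show ?thesis
  proof (cases "i < k + m")
    case False
    then have V1: "?V $$ (i, i) = 1" using i by (simp add: voting_matrix_def)
    have "?P x i \<le> ?P (Suc x) i" for x
      unfolding e[OF i]
      using member_le_sum[of i "{..<?N}" "\<lambda>l. ?V $$ (i, l) * ?P x l"] V1 i pw
        voting_matrix_nonneg[OF assms(1-4) i] by simp
    then have "incseq (\<lambda>x. ?P x i)" by (rule incseq_SucI)
    then obtain L where "(\<lambda>x. ?P x i) \<longlonglongrightarrow> L"
      by (rule incseq_convergent) (use le1[OF i] in blast)
    then show ?thesis by (rule convergentI)
  next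
    case True
    define c where "c = max (1 - \<alpha> Block_A) (1 - \<alpha> Block_B)"
    define T where "T x = (\<Sum>i<k + m. ?P x i)" for x
    have c: "0 \<le> c" "c < 1" "1 - \<alpha> X \<le> c" for X
      using spec[OF assms(3), of Block_A] spec[OF assms(3), of Block_B] by (cases X; auto simp: c_def)+
    have pos: "0 \<le> ?P x l" if "l < ?N" for x l using pw that by blast
    have "T (Suc x) \<le> c * T x" for x
    proof -
      have "T (Suc x) = (\<Sum>i<k + m. \<Sum>l<?N. ?V $$ (i, l) * ?P x l)"
        unfolding T_def by (intro sum.cong refl e) auto
      also have "\<dots> = (\<Sum>l<?N. \<Sum>i<k + m. ?V $$ (i, l) * ?P x l)" by (rule sum.swap)
      also have "\<dots> = (\<Sum>l<?N. (\<Sum>i<k + m. ?V $$ (i, l)) * ?P x l)"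
        by (simp only: sum_distrib_right)
      also have "\<dots> = (\<Sum>l<k + m. (\<Sum>i<k + m. ?V $$ (i, l)) * ?P x l)"
      proof (rule sum.mono_neutral_right)
        show "\<forall>l\<in>{..<?N} - {..<k + m}. (\<Sum>i<k + m. ?V $$ (i, l)) * ?P x l = 0"
          by (auto intro!: sum.neutral simp: voting_matrix_def)
      qed auto
      also have "\<dots> \<le> (\<Sum>l<k + m. c * ?P x l)"
        using c(3) pos voting_matrix_sum_voters[OF assms(1,2,4)]
        by (intro sum_mono mult_right_mono) auto
      finally show ?thesis by (simp add: T_def sum_distrib_left)
    qed
    note step = this
    have T: "T x \<le> c ^ x * T 0" for x
    proof (induction x)
      case (Suc x)
      have "T (Suc x) \<le> c * T x" by (rule step)
      also have "\<dots> \<le> c * (c ^ x * T 0)" using Suc c(1) by (rule mult_left_mono)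
      finally show ?case by simp
    qed simp
    have bd: "?P x i \<le> c ^ x * T 0" for x
      using T[of x] member_le_sum[of i "{..<k + m}" "?P x"] True pos by (auto simp: T_def)
    have lim0: "(\<lambda>x. c ^ x * T 0) \<longlonglongrightarrow> 0"
      using c by (intro tendsto_mult_left_zero LIMSEQ_realpow_zero) auto
    have lo: "\<forall>\<^sub>F x in sequentially. 0 \<le> ?P x i"
      by (rule always_eventually) (use pos[OF i] in blast)
    have up: "\<forall>\<^sub>F x in sequentially. ?P x i \<le> c ^ x * T 0"
      by (rule always_eventually) (use bd in blast)
    have "(\<lambda>x. ?P x i) \<longlonglongrightarrow> 0"
      by (rule tendsto_sandwich[OF lo up tendsto_const lim0])
    then show ?thesis by (rule convergentI)
  qed
qed

end

theory Submission
  imports Defs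
begin

text \<open>
  Already after one step, block A has put the mass \<open>k * \<alpha> Block_A\<close> on its policy, and mass on a
  policy never leaves it. Since \<open>n + (k - m) = 2 * k\<close>, the hypothesis says exactly that this is at
  least \<open>n / 2\<close>, half of the total mass available to both policies.
\<close>

text \<open>A policy is absorbing, so the diagonal entry of its row is 1. The previous entry is
  therefore one summand of the next one, and all other summands are nonnegative.\<close>

lemma voting_matrix_power_policy_incseq:
  assumes "1 \<le> k" "1 \<le> m" "\<forall>X. 0 < \<alpha> X \<and> \<alpha> X \<le> 1" "admissible_leakage k m lam"
    and j: "j < k + m + 2"
  shows "incseq (\<lambda>x. (voting_matrix k m \<alpha> lam ^\<^sub>m x) $$ (policy k m X, j))"
proof (rule incseq_SucI)
  fix x
  let ?V = "voting_matrix k m \<alpha> lam" and ?N = "k + m + 2" and ?p = "policy k m X"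
  have p: "?p < ?N" "\<not> ?p < k + m" by (cases X; simp)+
  have "(?V ^\<^sub>m Suc x) $$ (?p, j) = (\<Sum>l<?N. ?V $$ (?p, l) * (?V ^\<^sub>m x) $$ (l, j))"
    using times_mat_entry[OF voting_matrix_carrier pow_carrier_mat[OF voting_matrix_carrier] p(1) j]
    by (simp only: pow_mat_Suc_left[OF voting_matrix_carrier])
  moreover have "?V $$ (?p, ?p) = 1" using p by (simp add: voting_matrix_def)
  ultimately show "(?V ^\<^sub>m x) $$ (?p, j) \<le> (?V ^\<^sub>m Suc x) $$ (?p, j)"
    using member_le_sum[of ?p "{..<?N}" "\<lambda>l. ?V $$ (?p, l) * (?V ^\<^sub>m x) $$ (l, j)"] p(1)
      voting_matrix_power[OF assms(1-4) j] voting_matrix_nonneg[OF assms(1-4) p(1)] by simp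
qed

text \<open>\<open>lim\<close> is meaningful only for a convergent sequence;
  \<open>voting_matrix_convergent\<close> supplies that here.\<close>

lemma limit_matrix_LIMSEQ:
  assumes "1 \<le> k" "1 \<le> m" "\<forall>X. 0 < \<alpha> X \<and> \<alpha> X \<le> 1" "admissible_leakage k m lam"
    and "i < k + m + 2" "j < k + m + 2"
  shows "(\<lambda>x. (voting_matrix k m \<alpha> lam ^\<^sub>m x) $$ (i, j)) \<longlonglongrightarrow> limit_matrix k m \<alpha> lam $$ (i, j)"
  using voting_matrix_convergent[OF assms] assms(5,6)
  by (simp add: limit_matrix_def convergent_LIMSEQ_iff)

lemma voting_matrix_le_limit_matrix:
  assumes "1 \<le> k" "1 \<le> m" "\<forall>X. 0 < \<alpha> X \<and> \<alpha> X \<le> 1" "admissible_leakage k m lam"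
    and j: "j < k + m + 2"
  shows "voting_matrix k m \<alpha> lam $$ (policy k m X, j) \<le> limit_matrix k m \<alpha> lam $$ (policy k m X, j)"
proof -
  have "policy k m X < k + m + 2" by (cases X) auto
  \<comment> \<open>An increasing sequence stays below its limit; index 1 picks the first power,
    which unfolds to the identity matrix times the voting matrix.\<close>
  from incseq_le[OF voting_matrix_power_policy_incseq[OF assms] limit_matrix_LIMSEQ[OF assms(1-4) this j], of 1]
  show ?thesis using voting_matrix_carrier[of k m \<alpha> lam] by (simp add: left_mult_one_mat)
qed

text \<open>Each column of each power sums to 1, and its voter entries are nonnegative. Dropping
  them leaves a bound that passes to the limit.\<close>

lemma limit_matrix_policies_le_1:
  assumes "1 \<le> k" "1 \<le> m" "\<forall>X. 0 < \<alpha> X \<and> \<alpha> X \<le> 1" "admissible_leakage k m lam"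
    and j: "j < k + m + 2"
  shows "limit_matrix k m \<alpha> lam $$ (policy k m Block_A, j) +
    limit_matrix k m \<alpha> lam $$ (policy k m Block_B, j) \<le> 1"
proof (rule LIMSEQ_le_const2)
  let ?P = "\<lambda>x i. (voting_matrix k m \<alpha> lam ^\<^sub>m x) $$ (i, j)"
  show "(\<lambda>x. ?P x (policy k m Block_A) + ?P x (policy k m Block_B)) \<longlonglongrightarrow>
      limit_matrix k m \<alpha> lam $$ (policy k m Block_A, j) + limit_matrix k m \<alpha> lam $$ (policy k m Block_B, j)"
    by (intro tendsto_add limit_matrix_LIMSEQ assms) auto
  have "?P x (k + m) + ?P x (k + m + 1) \<le> 1" for x
  proof -
    have "0 \<le> (\<Sum>i<k + m. ?P x i)"
      using voting_matrix_power[OF assms] by (intro sum_nonneg) auto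
    moreover have "(\<Sum>i<k + m + 2. ?P x i) = (\<Sum>i<k + m. ?P x i) + ?P x (k + m) + ?P x (k + m + 1)"
      by (simp add: numeral_2_eq_2)
    ultimately show ?thesis using voting_matrix_power[OF assms, of x] by linarith
  qed
  then show "\<exists>N. \<forall>x\<ge>N. ?P x (policy k m Block_A) + ?P x (policy k m Block_B) \<le> 1" by simp
qed

text \<open>Only the mass that the voters of block A send directly to their policy is counted.
  Leakage does not enter these entries, so the bound is uniform in \<open>lam\<close>.\<close>

lemma absorbed_mass_A_ge:
  assumes "1 \<le> k" "1 \<le> m" "\<forall>X. 0 < \<alpha> X \<and> \<alpha> X \<le> 1" "admissible_leakage k m lam"
  shows "real k * \<alpha> Block_A \<le> absorbed_mass k m \<alpha> lam Block_A"
proof -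
  let ?V = "voting_matrix k m \<alpha> lam" and ?p = "policy k m Block_A"
  have "real k * \<alpha> Block_A = (\<Sum>j<k. ?V $$ (?p, j))"
    by (simp add: voting_matrix_def voter_column_def block_of_def)
  also have "\<dots> \<le> (\<Sum>j<k + m. ?V $$ (?p, j))"
    using voting_matrix_nonneg[OF assms] by (intro sum_mono2) auto
  also have "\<dots> \<le> absorbed_mass k m \<alpha> lam Block_A"
    unfolding absorbed_mass_def by (intro sum_mono voting_matrix_le_limit_matrix assms) auto
  finally show ?thesis .
qed

lemma absorbed_mass_sum_le:
  assumes "1 \<le> k" "1 \<le> m" "\<forall>X. 0 < \<alpha> X \<and> \<alpha> X \<le> 1" "admissible_leakage k m lam"
  shows "absorbed_mass k m \<alpha> lam Block_A + absorbed_mass k m \<alpha> lam Block_B \<le> real (k + m)"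
proof -
  have "absorbed_mass k m \<alpha> lam Block_A + absorbed_mass k m \<alpha> lam Block_B \<le> (\<Sum>j<k + m. 1)"
    unfolding absorbed_mass_def sum.distrib[symmetric]
    by (intro sum_mono limit_matrix_policies_le_1 assms) auto
  then show ?thesis by simp
qed

theorem corollary1:
  fixes k m n :: nat and \<alpha> :: "block \<Rightarrow> real" and r_A :: real
  assumes "1 \<le> m" and "m \<le> k" and "n = k + m"
    and "\<forall>X. 0 < \<alpha> X \<and> \<alpha> X \<le> 1"
    and "r_A = (1 - \<alpha> Block_A) / \<alpha> Block_A"
  shows "(real k - real m \<ge> real n * r_A \<longleftrightarrow>
            \<alpha> Block_A \<ge> real n / (real n + (real k - real m))) \<and>
         (real k - real m \<ge> real n * r_A \<longrightarrow>
            (\<forall>lam. admissible_leakage k m lam \<longrightarrow> \<not> overturns_majority k m \<alpha> lam))"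
proof -
  have k: "1 \<le> k" using assms(1,2) by simp
  have \<alpha>: "0 < \<alpha> Block_A" using assms(4) by blast
  have n: "real n = real k + real m" using assms(3) by simp
  \<comment> \<open>Multiplying by \<alpha>_A > 0 gives (k - m) \<alpha>_A \<ge> (k + m) (1 -
    \<alpha>_A), and collecting the \<alpha>_A terms leaves 2 k \<alpha>_A \<ge> k + m.\<close>
  have 1: "real k - real m \<ge> real n * r_A \<longleftrightarrow> real n \<le> 2 * (real k * \<alpha> Block_A)"
    using \<alpha> by (simp add: assms(5) n field_simps)
  have 2: "\<alpha> Block_A \<ge> real n / (real n + (real k - real m)) \<longleftrightarrow> real n \<le> 2 * (real k * \<alpha> Block_A)"
    using k by (simp add: n field_simps)
  \<comment> \<open>Here M_A \<ge> n / 2 and M_A + M_B \<le> n, hence M_B \<le> n / 2 \<le> M_A. A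
    tie is possible in this bound and does not count as an overturn.\<close>
  have 3: "\<not> overturns_majority k m \<alpha> lam"
    if "real n \<le> 2 * (real k * \<alpha> Block_A)" "admissible_leakage k m lam" for lam
    using that(1) absorbed_mass_A_ge[OF k assms(1,4) that(2)]
      absorbed_mass_sum_le[OF k assms(1,4) that(2)] assms(3)
    by (simp add: overturns_majority_def)
  show ?thesis using 1 2 3 by blast
qed

end
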